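(* Let $(\mathcal{X},\|\cdot\|)$ be a finite-dimensional real normed vector space and let $T:\mathcal{X}\to\mathcal{X}$ be a nonexpansive map. Then the following are equivalent: (i) for every vector $g\in\mathcal{X}$, the map $g+T$ (i.e., $x\mapsto g+T(x)$) has a fixed point; (ii) every nonexpansive map $G:\mathcal{X}\to\mathcal{X}$ such that $\sup_{x\in\mathcal{X}}\|G(x)-T(x)\|<\infty$ has a fixed point; (iii) for every scalar $\alpha\geq0$, the set $\mathcal{D}_\alpha(T)=\{x\in\mathcal{X}\mid\|x-T(x)\|\leq\alpha\}$ is bounded.
   Context: A map $T:\mathcal{X}\to\mathcal{X}$ is nonexpansive if $\|T(x)-T(y)\|\leq\|x-y\|$ for all $x,y\in\mathcal{X}$. *)

theory Defs
  imports "HOL-Analysis.Analysis"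
begin

definition nonexpansive :: "('a::real_normed_vector \<Rightarrow> 'a) \<Rightarrow> bool" where
  "nonexpansive T \<longleftrightarrow> (\<forall>x y. norm (T x - T y) \<le> norm (x - y))"

definition approx_fixed_set :: "real \<Rightarrow> ('a::real_normed_vector \<Rightarrow> 'a) \<Rightarrow> 'a set" where
  "approx_fixed_set \<alpha> T = {x. norm (x - T x) \<le> \<alpha>}"

end

theory Submission
  imports Defs
begin

text \<open>
  If \<open>T\<close> is almost fixed along an unbounded sequence \<open>x n\<close>, then by compactness
  \<open>x n - T (x n)\<close> tends to some \<open>y\<close> and \<open>x n /\<^sub>R norm (x n)\<close> to some unit vector \<open>u\<close>,
  along a subsequence. A point \<open>z\<close> with \<open>z - T z = y + u\<close> would give
  \<open>norm (T (x n) - T z) \<approx> norm (x n - z + u) \<approx> norm (x n - z) + 1\<close>, contradicting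
  nonexpansiveness; so the translate of \<open>T\<close> by \<open>y + u\<close> has no fixed point.
  Conversely, the fixed points of the contractions \<open>\<lambda>x. c *\<^sub>R G x\<close> with \<open>c < 1\<close> are moved by \<open>G\<close>
  at most \<open>norm (G 0)\<close>, so they stay bounded, and any limit point as \<open>c\<close> tends to \<open>1\<close> is
  fixed by \<open>G\<close>.
\<close>

section \<open>Compactness of balls in finitely generated normed spaces\<close>

lemma closed_span_if_compact_Int_cball:
  fixes B :: "'a::real_normed_vector set"
  assumes "\<And>r. compact (span B \<inter> cball 0 r)"
  shows "closed (span B)"
  unfolding closed_sequential_limits
proof (intro allI impI, elim conjE)
  fix s l assume s: "\<forall>n. s n \<in> span B" and l: "s \<longlonglongrightarrow> l"
  from l have "bounded (range s)" by (rule convergent_imp_bounded)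
  then obtain r where "\<And>n. norm (s n) \<le> r" unfolding bounded_iff by auto
  with s have "\<forall>n. s n \<in> span B \<inter> cball 0 r" by simp
  moreover have "closed (span B \<inter> cball 0 r)" using assms by (rule compact_imp_closed)
  ultimately have "l \<in> span B \<inter> cball 0 r" using l unfolding closed_sequential_limits by blast
  then show "l \<in> span B" by simp
qed

text \<open>Adding a vector \<open>b\<close> outside \<open>span B\<close>, which is closed by
  induction, keeps \<open>b\<close> at positive distance from \<open>span B\<close>. This bounds the
  coefficient of \<open>b\<close> on any ball, so the ball is a closed part of a continuous image of
  a compact product.\<close>

lemma compact_span_Int_cball:
  fixes B :: "'a::real_normed_vector set"
  assumes "finite B"
  shows "compact (span B \<inter> cball 0 r)"
  using assms
proof (induction B arbitrary: r rule: finite_induct)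
  case empty
  have "span {} \<inter> cball 0 r = (if r \<ge> 0 then {0::'a} else {})" by auto
  then show ?case by simp
next
  case (insert b B)
  have cl: "closed (span B)" using insert.IH by (rule closed_span_if_compact_Int_cball)
  show ?case
  proof (cases "b \<in> span B")
    case True
    then show ?thesis using insert.IH by (simp add: span_redundant)
  next
    case False
    then obtain e where e: "e > 0" "ball b e \<subseteq> - span B"
      using cl open_contains_ball[of "- span B"] by (auto simp: open_closed)
    \<comment> \<open>For nonzero \<open>a\<close>, dividing by \<open>a\<close> reduces this to the
      distance of at least \<open>e\<close> between \<open>b\<close> and the point
      \<open>- (s /\<^sub>R a)\<close> of the span.\<close>
    have coeff: "\<bar>a\<bar> * e \<le> norm (a *\<^sub>R b + s)" if s: "s \<in> span B" for a s
    proof (cases "a = 0")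
      case False
      have "- (s /\<^sub>R a) \<in> span B" using s by (intro span_neg span_scale)
      then have "- (s /\<^sub>R a) \<notin> ball b e" using e by blast
      then have "e \<le> norm (b + s /\<^sub>R a)" by (simp add: dist_norm)
      then have "\<bar>a\<bar> * e \<le> \<bar>a\<bar> * norm (b + s /\<^sub>R a)" by (intro mult_left_mono) auto
      also have "\<dots> = norm (a *\<^sub>R (b + s /\<^sub>R a))" by simp
      also have "a *\<^sub>R (b + s /\<^sub>R a) = a *\<^sub>R b + s" using False by (simp add: scaleR_add_right)
      finally show ?thesis .
    qed simp
    \<comment> \<open>If \<open>norm x \<le> r\<close>, then \<open>coeff\<close> gives
      \<open>\<bar>a\<bar> \<le> r / e\<close>, and \<open>R\<close> bounds the remaining component
      \<open>x - a *\<^sub>R b\<close>. The set \<open>K\<close> may reach beyond the ball, so it is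
      cut with \<open>cball 0 r\<close> below.\<close>
    define R where "R = r + r / e * norm b"
    define K where "K = (\<lambda>(a, s). a *\<^sub>R b + s) ` ({- (r / e)..r / e} \<times> (span B \<inter> cball 0 R))"
    have "compact K" unfolding K_def
      by (intro compact_continuous_image compact_Times insert.IH)
        (auto simp: case_prod_unfold intro!: continuous_intros)
    moreover have "span (insert b B) \<inter> cball 0 r = K \<inter> cball 0 r"
    proof (intro equalityI subsetI)
      fix x assume x: "x \<in> span (insert b B) \<inter> cball 0 r"
      then obtain a where a: "x - a *\<^sub>R b \<in> span B" by (auto simp: span_insert)
      have nx: "norm x \<le> r" using x by simp
      have "\<bar>a\<bar> * e \<le> r" using coeff[OF a, of a] nx by simp
      then have ar: "\<bar>a\<bar> \<le> r / e" using e by (simp add: field_simps)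
      have "norm (x - a *\<^sub>R b) \<le> norm x + \<bar>a\<bar> * norm b"
        using norm_triangle_ineq4[of x "a *\<^sub>R b"] by simp
      also have "\<dots> \<le> R" unfolding R_def using nx ar by (intro add_mono mult_right_mono) auto
      finally have "(a, x - a *\<^sub>R b) \<in> {- (r / e)..r / e} \<times> (span B \<inter> cball 0 R)"
        using a ar by auto
      then have "x \<in> K" unfolding K_def by (rule rev_image_eqI) simp
      then show "x \<in> K \<inter> cball 0 r" using x by simp
    next
      fix x assume x: "x \<in> K \<inter> cball 0 r"
      then obtain a s where "s \<in> span B" "x = a *\<^sub>R b + s" unfolding K_def by auto
      then have "x - a *\<^sub>R b \<in> span B" by simp
      then show "x \<in> span (insert b B) \<inter> cball 0 r" using x by (auto simp: span_insert)
    qed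
    ultimately show ?thesis by (simp add: compact_Int_closed)
  qed
qed

lemma bounded_seq_has_convergent_subseq:
  fixes s :: "nat \<Rightarrow> 'a::real_normed_vector"
  assumes "finite B" "span B = (UNIV :: 'a set)" "bounded (range s)"
  obtains l \<phi> where "strict_mono (\<phi> :: nat \<Rightarrow> nat)" "(s \<circ> \<phi>) \<longlonglongrightarrow> l"
proof -
  obtain r where "\<And>n. norm (s n) \<le> r" using assms(3) unfolding bounded_iff by auto
  then have "\<forall>n. s n \<in> cball 0 r" by simp
  moreover have "compact (cball (0::'a) r)"
    using compact_span_Int_cball[OF assms(1), of r] assms(2) by simp
  ultimately show ?thesis using that unfolding compact_def by metis
qed

lemma complete_UNIV_finite_dim:
  assumes "finite B" "span B = (UNIV :: 'a::real_normed_vector set)"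
  shows "complete (UNIV :: 'a set)"
  unfolding complete_def
proof (intro allI impI, elim conjE)
  fix f :: "nat \<Rightarrow> 'a" assume f: "Cauchy f"
  obtain l \<phi> where "strict_mono (\<phi> :: nat \<Rightarrow> nat)" "(f \<circ> \<phi>) \<longlonglongrightarrow> l"
    using bounded_seq_has_convergent_subseq[OF assms cauchy_imp_bounded[OF f]] .
  then have "f \<longlonglongrightarrow> l" using f by (metis Cauchy_converges_subseq)
  then show "\<exists>l\<in>UNIV. f \<longlonglongrightarrow> l" by blast
qed

section \<open>Fixed points of nonexpansive maps by approximation with contractions\<close>

lemma nonexpansive_continuous:
  assumes "nonexpansive T"
  shows "continuous_on S T"
proof -
  have "1-lipschitz_on S T"
    using assms by (intro lipschitz_onI) (auto simp: nonexpansive_def dist_norm)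
  then show ?thesis by (rule lipschitz_on_continuous_on)
qed

lemma nonexpansive_scaleR_fixed_point:
  fixes G :: "'a::real_normed_vector \<Rightarrow> 'a"
  assumes "complete (UNIV :: 'a set)" "nonexpansive G" "0 \<le> c" "c < 1"
  obtains x where "c *\<^sub>R G x = x"
proof -
  have "\<exists>!x\<in>UNIV. c *\<^sub>R G x = x"
  proof (rule Banach_fix[OF assms(1) UNIV_not_empty assms(3,4) subset_UNIV])
    show "dist (c *\<^sub>R G x) (c *\<^sub>R G y) \<le> c * dist x y" for x y
      using assms(2,3)
      by (auto simp: dist_norm nonexpansive_def mult_left_mono simp flip: scaleR_diff_right)
  qed
  then show ?thesis using that by blast
qed

text \<open>The displacement has norm \<open>(1 - c) * norm (G x)\<close>, while
  \<open>norm (G x) \<le> c * norm (G x) + norm (G 0)\<close>. The bound is free of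
  \<open>c\<close>, so one approximate fixed set holds the fixed points of all the
  contractions.\<close>

lemma nonexpansive_displacement_le:
  assumes "nonexpansive G" "c *\<^sub>R G x = x" "0 \<le> c" "c < 1"
  shows "norm (x - G x) \<le> norm (G 0)"
proof -
  have "norm (G x) \<le> norm (G x - G 0) + norm (G 0)"
    by (metis add.commute norm_triangle_sub)
  also have "\<dots> \<le> norm x + norm (G 0)" using assms(1) by (metis add_right_mono diff_zero nonexpansive_def)
  also have "norm x = c * norm (G x)" using assms(2,3) by (metis norm_scaleR abs_of_nonneg)
  finally have "(1 - c) * norm (G x) \<le> norm (G 0)" by (simp add: algebra_simps)
  moreover have "G x - x = (1 - c) *\<^sub>R G x" using assms(2) by (simp add: scaleR_diff_left)
  then have "norm (x - G x) = (1 - c) * norm (G x)"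
    using assms(4) by (metis abs_of_pos diff_gt_0_iff_gt norm_minus_commute norm_scaleR)
  ultimately show ?thesis by simp
qed

lemma nonexpansive_fixed_point:
  fixes G :: "'a::real_normed_vector \<Rightarrow> 'a"
  assumes fd: "finite B" "span B = (UNIV :: 'a set)"
    and G: "nonexpansive G" and bd: "bounded (approx_fixed_set (norm (G 0)) G)"
  obtains x where "G x = x"
proof -
  define c where "c n = 1 - 1 / real (Suc n)" for n
  have c: "0 \<le> c n" "c n < 1" for n by (auto simp: c_def field_simps)
  have "c \<longlonglongrightarrow> 1 - 0" unfolding c_def
    by (intro tendsto_diff tendsto_const LIMSEQ_Suc[OF lim_1_over_n])
  then have lim_c: "c \<longlonglongrightarrow> 1" by simp
  have "\<exists>x. c n *\<^sub>R G x = x" for n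
    using nonexpansive_scaleR_fixed_point[OF complete_UNIV_finite_dim[OF fd] G c] by blast
  then obtain s where s: "\<And>n. c n *\<^sub>R G (s n) = s n" by metis
  have "range s \<subseteq> approx_fixed_set (norm (G 0)) G"
    using nonexpansive_displacement_le[OF G s c] by (auto simp: approx_fixed_set_def)
  then have "bounded (range s)" using bd bounded_subset by blast
  then obtain l \<phi> where \<phi>: "strict_mono (\<phi> :: nat \<Rightarrow> nat)" and l: "(s \<circ> \<phi>) \<longlonglongrightarrow> l"
    using bounded_seq_has_convergent_subseq[OF fd] by blast
  have "(G \<circ> (s \<circ> \<phi>)) \<longlonglongrightarrow> G l"
    using nonexpansive_continuous[OF G, of UNIV] l
    by (auto simp: continuous_on_sequentially)
  moreover have "(c \<circ> \<phi>) \<longlonglongrightarrow> 1" using lim_c \<phi> by (rule LIMSEQ_subseq_LIMSEQ)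
  ultimately have "(\<lambda>n. (c \<circ> \<phi>) n *\<^sub>R (G \<circ> (s \<circ> \<phi>)) n) \<longlonglongrightarrow> 1 *\<^sub>R G l"
    by (intro tendsto_scaleR)
  then have "(s \<circ> \<phi>) \<longlonglongrightarrow> G l" by (simp add: s o_def)
  then have "G l = l" using l by (rule LIMSEQ_unique)
  then show ?thesis by (rule that)
qed

section \<open>Boundedness of approximate fixed sets from fixed points of translates\<close>

lemma bounded_approx_fixed_set_if_translates_fixed:
  fixes T :: "'a::real_normed_vector \<Rightarrow> 'a"
  assumes fd: "finite B" "span B = (UNIV :: 'a set)"
    and T: "nonexpansive T" and fp: "\<And>g. \<exists>x. g + T x = x"
  shows "bounded (approx_fixed_set \<alpha> T)"
proof (rule ccontr)
  assume "\<not> bounded (approx_fixed_set \<alpha> T)"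
  then have "\<exists>x. norm (x - T x) \<le> \<alpha> \<and> real n < norm x" for n
    unfolding bounded_iff approx_fixed_set_def by (force simp: not_le)
  then obtain x where x: "\<And>n. norm (x n - T (x n)) \<le> \<alpha>" "\<And>n. real n < norm (x n)" by metis
  define d where "d n = x n - T (x n)" for n
  have "bounded (range d)" using x(1) unfolding bounded_iff d_def by auto
  then obtain y \<phi> where \<phi>: "strict_mono (\<phi> :: nat \<Rightarrow> nat)" and y: "(d \<circ> \<phi>) \<longlonglongrightarrow> y"
    using bounded_seq_has_convergent_subseq[OF fd] by blast
  have "bounded (range (\<lambda>n. sgn (x (\<phi> n))))"
    unfolding bounded_iff by (intro exI[of _ 1]) (auto simp: norm_sgn)
  \<comment> \<open>The second extraction refines the first, so both limits hold along the indices
    \<open>\<phi> (\<psi> n)\<close>.\<close>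
  then obtain u \<psi> where \<psi>: "strict_mono (\<psi> :: nat \<Rightarrow> nat)"
    and u: "((\<lambda>n. sgn (x (\<phi> n))) \<circ> \<psi>) \<longlonglongrightarrow> u"
    using bounded_seq_has_convergent_subseq[OF fd] by blast
  define w where "w n = x (\<phi> (\<psi> n))" for n
  have w_inf: "filterlim (\<lambda>n. norm (w n)) at_top sequentially"
  proof (rule filterlim_at_top_mono[OF filterlim_real_sequentially])
    have "real n \<le> norm (w n)" for n
      using x(2)[of "\<phi> (\<psi> n)"] seq_suble[OF \<phi>, of "\<psi> n"] seq_suble[OF \<psi>, of n]
      unfolding w_def by linarith
    then show "\<forall>\<^sub>F n in sequentially. real n \<le> norm (w n)" by simp
  qed
  have lim_d: "(\<lambda>n. d (\<phi> (\<psi> n))) \<longlonglongrightarrow> y"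
    using LIMSEQ_subseq_LIMSEQ[OF y \<psi>] by (simp add: o_def)
  have lim_u: "(\<lambda>n. sgn (w n)) \<longlonglongrightarrow> u" using u by (simp add: w_def o_def)
  obtain z where z: "(y + u) + T z = z" using fp by blast
  \<comment> \<open>Dividing \<open>w n - z\<close> by \<open>norm (w n)\<close> instead of its own
    norm leaves the limit \<open>u\<close> unchanged, since \<open>norm (w n)\<close> tends to
    infinity, and makes \<open>p n\<close> a nonnegative multiple of \<open>w n - z\<close>.\<close>
  define p where "p n = (w n - z) /\<^sub>R norm (w n)" for n
  have "(\<lambda>n. sgn (w n) - inverse (norm (w n)) *\<^sub>R z) \<longlonglongrightarrow> u - 0 *\<^sub>R z"
    by (intro tendsto_intros lim_u tendsto_inverse_0_at_top w_inf)
  then have lim_p: "p \<longlonglongrightarrow> u" by (simp add: p_def[abs_def] sgn_div_norm scaleR_diff_right)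
  \<comment> \<open>Norms of the parallel vectors \<open>v\<close> and \<open>p n\<close> add up
    exactly. Trading \<open>p n\<close> for \<open>u\<close> and \<open>D\<close> for
    \<open>y\<close> costs only the two error terms, and nonexpansiveness then cancels
    \<open>norm v\<close>. In the limit this forces \<open>u = 0\<close>.\<close>
  have "norm (p n) \<le> norm (p n - u) + norm (d (\<phi> (\<psi> n)) - y)" for n
  proof -
    define v where "v = w n - z"
    define D where "D = d (\<phi> (\<psi> n))"
    have "T z = z - (y + u)" using z by (metis add_diff_cancel_left')
    moreover have "T (w n) = w n - D" by (simp add: D_def d_def w_def)
    ultimately have "T (w n) - T z = v + u - (D - y)" by (simp add: v_def)
    then have ne: "norm (v + u - (D - y)) \<le> norm v"
      using T unfolding nonexpansive_def v_def by metis
    have "v + p n = (1 + inverse (norm (w n))) *\<^sub>R v"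
      by (simp add: p_def v_def scaleR_add_left)
    then have "norm (v + p n) = (1 + inverse (norm (w n))) * norm v" by simp
    also have "\<dots> = norm v + norm (p n)" by (simp add: p_def v_def distrib_right)
    finally have "norm v + norm (p n) = norm ((v + u - (D - y)) + ((p n - u) + (D - y)))" by simp
    also have "\<dots> \<le> norm (v + u - (D - y)) + (norm (p n - u) + norm (D - y))"
      by (intro norm_triangle_mono norm_triangle_ineq order_refl)
    finally show ?thesis using ne by (simp add: D_def)
  qed
  moreover have "(\<lambda>n. norm (p n - u) + norm (d (\<phi> (\<psi> n)) - y)) \<longlonglongrightarrow> norm (u - u) + norm (y - y)"
    by (intro tendsto_intros lim_p lim_d)
  ultimately have "norm u \<le> norm (u - u) + norm (y - y)"
    using tendsto_norm[OF lim_p] by (intro LIMSEQ_le) auto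
  moreover have "norm u = 1"
  proof -
    have "w n \<noteq> 0" for n using x(2)[of "\<phi> (\<psi> n)"] unfolding w_def by force
    then have "(\<lambda>n. norm (sgn (w n))) = (\<lambda>n. 1)" by (simp add: norm_sgn)
    then show ?thesis using tendsto_norm[OF lim_u] by (simp add: LIMSEQ_const_iff)
  qed
  ultimately show False by simp
qed

theorem corollary4p2:
  fixes T :: "'a::real_normed_vector \<Rightarrow> 'a"
  assumes "\<exists>B :: 'a set. finite B \<and> span B = UNIV"
    and "nonexpansive T"
  shows "((\<forall>g. \<exists>x. g + T x = x) \<longleftrightarrow>
          (\<forall>G. nonexpansive G \<and> bdd_above (range (\<lambda>x. norm (G x - T x))) \<longrightarrow> (\<exists>x. G x = x)))
       \<and> ((\<forall>G. nonexpansive G \<and> bdd_above (range (\<lambda>x. norm (G x - T x))) \<longrightarrow> (\<exists>x. G x = x)) \<longleftrightarrow>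
          (\<forall>\<alpha>\<ge>0. bounded (approx_fixed_set \<alpha> T)))"
    (is "(?translates \<longleftrightarrow> ?perturbations) \<and> (_ \<longleftrightarrow> ?bounded)")
proof -
  obtain B :: "'a set" where fd: "finite B" "span B = UNIV" using assms(1) by blast
  \<comment> \<open>The equivalences follow from the cycle (iii) to (ii) to (i) to (iii).\<close>
  have "?perturbations" if bd: ?bounded
  proof (intro allI impI, elim conjE)
    fix G :: "'a \<Rightarrow> 'a"
    assume G: "nonexpansive G" and "bdd_above (range (\<lambda>x. norm (G x - T x)))"
    then obtain M where M: "\<And>x. norm (G x - T x) \<le> M" unfolding bdd_above_def by auto
    \<comment> \<open>Displacements under \<open>G\<close> and \<open>T\<close> differ by at most
      \<open>M\<close>, so boundedness for \<open>T\<close> at level \<open>norm (G 0) + M\<close>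
      carries over to \<open>G\<close> at level \<open>norm (G 0)\<close>.\<close>
    have "norm (x - T x) \<le> norm (x - G x) + M" for x
      using norm_triangle_ineq[of "x - G x" "G x - T x"] M[of x] by simp
    then have "approx_fixed_set (norm (G 0)) G \<subseteq> approx_fixed_set (norm (G 0) + M) T"
      unfolding approx_fixed_set_def by (smt (verit) Collect_mono)
    moreover have "0 \<le> norm (G 0) + M"
      using M[of 0] by (meson add_nonneg_nonneg norm_ge_zero order_trans)
    ultimately have "bounded (approx_fixed_set (norm (G 0)) G)"
      using bd bounded_subset by blast
    then show "\<exists>x. G x = x" using nonexpansive_fixed_point[OF fd G] by blast
  qed
  moreover have "?translates" if pert: ?perturbations
  proof
    fix g
    have "nonexpansive (\<lambda>x. g + T x)" using assms(2) by (simp add: nonexpansive_def)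
    \<comment> \<open>A translate differs from \<open>T\<close> by the constant \<open>g\<close>, so
      it is an admissible perturbation.\<close>
    then show "\<exists>x. g + T x = x" using pert[rule_format, of "\<lambda>x. g + T x"] by simp
  qed
  moreover have ?bounded if ?translates
    using bounded_approx_fixed_set_if_translates_fixed[OF fd assms(2)] that by blast
  ultimately show ?thesis by blast
qed

end
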